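(* Let $\mathcal{F}$ be the family of all distance-regular graphs with diameter $d\geq 1$ and the same given intersection array $\{b_0,b_1,\ldots,b_{d-1};c_1,\ldots,c_d\}$. Then, for every graph $G\in\mathcal{F}$, with $2$-token graph $F_2=F_2(G)$, the $d$ eigenvalues of the matrix $A(F_2/\pi)$ are eigenvalues of the adjacency matrix of $F_2$, and the $d$ eigenvalues of the matrix $L(F_2/\pi)$ are eigenvalues of the Laplacian matrix of $F_2$ (both matrices depend only on the intersection array and are defined in the context). In particular, the adjacency spectral radius of $F_2$ is $\rho_A(F_2)=\rho_A(F_2/\pi)$ and, if $G$ is bipartite, the Laplacian spectral radius of $F_2$ is $\rho_L(F_2)=\rho_L(F_2/\pi)$.
   Context: All graphs are finite, simple, and the distance-regular graphs $G$ are connected. For $G=(V,E)$, the $2$-token graph $F_2(G)$ has as vertices the $2$-subsets of $V$, and two $2$-subsets $A,B$ are adjacent if and only if their symmetric difference is a pair $\{a,b\}$ with $a\in A$, $b\in B$ and $\{a,b\}\in E$. The Laplacian matrix of a graph is the diagonal degree matrix minus the adjacency matrix; spectral radius means largest eigenvalue. In a distance-regular graph of degree $\delta=b_0$ and diameter $d$ with intersection array $\{b_0,\ldots,b_{d-1};c_1,\ldots,c_d\}$, for any vertices $u,v$ at distance $i$, the number of neighbors of $v$ at distance $i-1$, $i$, $i+1$ from $u$ is $c_i$, $a_i$, $b_i$, respectively (with $c_0=b_d=0$, $a_i+b_i+c_i=\delta$). The tridiagonal $d\times d$ matrices, with rows and columns indexed by $i=1,\dots,d$, are: $A(F_2/\pi)$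 with diagonal entries $2a_i$, entries $2b_i$ in position $(i,i+1)$ and $2c_i$ in position $(i,i-1)$, and zeros elsewhere; $L(F_2/\pi)$ with entries $-2b_i$ in position $(i,i+1)$, $-2c_i$ in position $(i,i-1)$, zeros in the other off-diagonal positions, and diagonal entries making all row sums zero (so $2b_1$, $2(c_i+b_i)$ for $2\le i\le d-1$, and $2c_d$ for $i=d\ge2$). $\rho_A(F_2/\pi)$ and $\rho_L(F_2/\pi)$ denote the largest eigenvalues of $A(F_2/\pi)$ and $L(F_2/\pi)$. *)

theory Defs
  imports
    "Graph_Theory.Graph_Theory"
    "Jordan_Normal_Form.Spectral_Radius"
begin

text \<open>
  A finite simple graph is a \<^locale>\<open>pair_graph\<close>: its edges are the arcs of a finite, loop-free,
  symmetric digraph, so the edge between \<open>u\<close> and \<open>v\<close> is the pair of arcs \<open>(u, v)\<close> and \<open>(v, u)\<close>.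
\<close>

text \<open>Every arc has cost 1, so this is the least length of a walk.\<close>

definition gdist :: "'a pair_pre_digraph \<Rightarrow> 'a \<Rightarrow> 'a \<Rightarrow> ereal" where
  "gdist G = wf_digraph.\<mu> (with_proj G) (\<lambda>_. 1)"

definition diameter :: "'a pair_pre_digraph \<Rightarrow> ereal" where
  "diameter G = (SUP u\<in>pverts G. SUP v\<in>pverts G. gdist G u v)"

definition bipartite :: "'a pair_pre_digraph \<Rightarrow> bool" where
  "bipartite G \<longleftrightarrow> (\<exists>X Y. X \<union> Y = pverts G \<and> X \<inter> Y = {} \<and> parcs G \<subseteq> X \<times> Y \<union> Y \<times> X)"

text \<open>
  An intersection array \<open>{b\<^sub>0, \<dots>, b\<^bsub>d-1\<^esub>; c\<^sub>1, \<dots>, c\<^sub>d}\<close> is given by \<open>d\<close> and two functions \<open>b\<close> and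
  \<open>c\<close>, extended by \<open>b d = 0\<close> and \<open>c 0 = 0\<close>. No other values of \<open>b\<close> and \<open>c\<close> matter below. The
  numbers \<open>a\<^sub>i\<close> are determined by \<open>a\<^sub>i + b\<^sub>i + c\<^sub>i = b\<^sub>0\<close>.
\<close>

definition array_a :: "(nat \<Rightarrow> nat) \<Rightarrow> (nat \<Rightarrow> nat) \<Rightarrow> nat \<Rightarrow> real" where
  "array_a b c i = real (b 0) - real (b i) - real (c i)"

text \<open>The distance \<open>i - 1\<close> is a real number, so that no vertex has it when \<open>i = 0\<close>.\<close>

definition distance_regular ::
    "'a pair_pre_digraph \<Rightarrow> nat \<Rightarrow> (nat \<Rightarrow> nat) \<Rightarrow> (nat \<Rightarrow> nat) \<Rightarrow> bool" where
  "distance_regular G d b c \<longleftrightarrow>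
     pair_graph G \<and> Digraph_Component.connected (with_proj G) \<and>
     diameter G = ereal (real d) \<and> b d = 0 \<and> c 0 = 0 \<and>
     (\<forall>u\<in>pverts G. \<forall>v\<in>pverts G. \<forall>i. gdist G u v = ereal (real i) \<longrightarrow>
        card {w. (v, w) \<in> parcs G \<and> gdist G u w = ereal (real i - 1)} = c i \<and>
        real (card {w. (v, w) \<in> parcs G \<and> gdist G u w = ereal (real i)}) = array_a b c i \<and>
        card {w. (v, w) \<in> parcs G \<and> gdist G u w = ereal (real i + 1)} = b i)"

definition token_graph2 :: "'a pair_pre_digraph \<Rightarrow> 'a set pair_pre_digraph" where
  "token_graph2 G =
     (let V2 = {A. A \<subseteq> pverts G \<and> card A = 2} in
      \<lparr>pverts = V2,
       parcs = {(A, B). A \<in> V2 \<and> B \<in> V2 \<and>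
                  (\<exists>a\<in>A. \<exists>b\<in>B. (A - B) \<union> (B - A) = {a, b} \<and> (a, b) \<in> parcs G)}\<rparr>)"

text \<open>
  The matrices of a graph are taken with respect to a list \<open>vs\<close> that enumerates its vertices
  without repetition.
\<close>

definition adjacency_matrix :: "'a pair_pre_digraph \<Rightarrow> 'a list \<Rightarrow> real mat" where
  "adjacency_matrix G vs =
     mat (length vs) (length vs) (\<lambda>(i, j). if (vs ! i, vs ! j) \<in> parcs G then 1 else 0)"

definition laplacian_matrix :: "'a pair_pre_digraph \<Rightarrow> 'a list \<Rightarrow> real mat" where
  "laplacian_matrix G vs =
     mat_diag (length vs) (\<lambda>i. real (out_degree (with_proj G) (vs ! i))) - adjacency_matrix G vs"

text \<open>
  The quotient matrices have rows and columns indexed by the distances \<open>1, \<dots>, d\<close>, whereas matrix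
  indices start at 0.
\<close>

definition quotient_offdiag :: "(nat \<Rightarrow> nat) \<Rightarrow> (nat \<Rightarrow> nat) \<Rightarrow> nat \<Rightarrow> nat \<Rightarrow> real" where
  "quotient_offdiag b c i j =
     (if j = i + 1 then 2 * real (b i) else if i = j + 1 then 2 * real (c i) else 0)"

definition quotient_adjacency :: "nat \<Rightarrow> (nat \<Rightarrow> nat) \<Rightarrow> (nat \<Rightarrow> nat) \<Rightarrow> real mat" where
  "quotient_adjacency d b c = mat d d (\<lambda>(r, s).
     let i = r + 1; j = s + 1 in
     if i = j then 2 * array_a b c i else quotient_offdiag b c i j)"

definition quotient_laplacian :: "nat \<Rightarrow> (nat \<Rightarrow> nat) \<Rightarrow> (nat \<Rightarrow> nat) \<Rightarrow> real mat" where
  "quotient_laplacian d b c = mat d d (\<lambda>(r, s).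
     let i = r + 1; j = s + 1 in
     if i = j then (\<Sum>k\<in>{1..d} - {i}. quotient_offdiag b c i k) else - quotient_offdiag b c i j)"

text \<open>The real eigenvalues, with their algebraic multiplicities.\<close>

definition eigenvalues_mset :: "real mat \<Rightarrow> real multiset" where
  "eigenvalues_mset M = proots (char_poly M)"

text \<open>
  Here the spectral radius is the largest eigenvalue, not the largest modulus of an eigenvalue
  (which is \<^const>\<open>spectral_radius\<close>).
\<close>

definition largest_eigenvalue :: "real mat \<Rightarrow> real" where
  "largest_eigenvalue M = Max (spectrum M)"

end

theory Submission
  imports Defs
begin

text \<open>
  The pairs of vertices of \<open>G\<close>, sorted by their distance, form an equitable partition of the token
  graph, because moving one token from a pair at distance \<open>i\<close> reaches \<open>2 c\<^sub>i\<close>, \<open>2 a\<^sub>i\<close>, \<open>2 b\<^sub>i\<close> pairs at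
  distance \<open>i - 1\<close>, \<open>i\<close>, \<open>i + 1\<close>. Hence the characteristic polynomials of the quotient matrices divide
  those of the full symmetric matrices, which split over the reals.

  A tridiagonal matrix with positive off-diagonal entries has a positive eigenvector. For the
  adjacency matrix it lifts to a positive vector that bounds all eigenvalues. If \<open>G\<close> is bipartite,
  then all \<open>a\<^sub>i\<close> vanish, so the entrywise absolute value of the Laplacian has the absolute value of
  the quotient Laplacian as its quotient, and the same argument applies to it; switching signs on
  the odd distances shows that the bound is an eigenvalue of the quotient Laplacian itself.
\<close>

section \<open>Quotients of equitable partitions\<close>

text \<open>A kernel on labels replaces index arithmetic: over a repetition-free list, a matrix
  product becomes a sum over the set of labels.\<close>

definition list_mat :: "('b \<Rightarrow> 'c \<Rightarrow> 'a) \<Rightarrow> 'b list \<Rightarrow> 'c list \<Rightarrow> 'a mat" where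
  "list_mat F xs ys = mat (length xs) (length ys) (\<lambda>(i, j). F (xs ! i) (ys ! j))"

lemma list_mat_carrier [simp]: "list_mat F xs ys \<in> carrier_mat (length xs) (length ys)"
  by (simp add: list_mat_def)

lemma list_mat_cong:
  assumes "\<And>x y. x \<in> set xs \<Longrightarrow> y \<in> set ys \<Longrightarrow> F x y = H x y"
  shows "list_mat F xs ys = list_mat H xs ys"
  using assms by (auto simp: list_mat_def intro!: eq_matI)

lemma sum_set_conv_nth:
  assumes "distinct ys"
  shows "(\<Sum>i<length ys. f (ys ! i)) = (\<Sum>y\<in>set ys. f y)"
  using sum.reindex_bij_betw[OF bij_betw_nth[OF assms refl refl], of f] by simp

lemma list_mat_mult:
  fixes F :: "'b \<Rightarrow> 'c \<Rightarrow> 'a :: comm_semiring_0"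
  assumes "distinct ys"
  shows "list_mat F xs ys * list_mat H ys zs = list_mat (\<lambda>x z. \<Sum>y\<in>set ys. F x y * H y z) xs zs"
  unfolding list_mat_def
  by (rule eq_matI)
    (auto simp: scalar_prod_def atLeast0LessThan sum_set_conv_nth[OF assms, symmetric])

lemma list_mat_one:
  assumes "distinct xs"
  shows "list_mat (\<lambda>x y. of_bool (x = y)) xs xs = (1\<^sub>m (length xs) :: 'a :: comm_ring_1 mat)"
  unfolding list_mat_def using assms by (intro eq_matI) (auto simp: nth_eq_iff_index_eq)

text \<open>The characteristic matrix is block upper triangular, so its determinant is the product
  of the determinants of its two diagonal blocks.\<close>

lemma char_poly_list_mat_block_dvd:
  fixes F :: "'b \<Rightarrow> 'b \<Rightarrow> 'a :: idom"
  assumes "\<And>x y. x \<in> set ys \<Longrightarrow> y \<in> set xs \<Longrightarrow> F x y = 0"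
  shows "char_poly (list_mat F xs xs) dvd char_poly (list_mat F (xs @ ys) (xs @ ys))"
proof -
  let ?n = "length xs" and ?m = "length ys"
  have "char_poly_matrix (list_mat F (xs @ ys) (xs @ ys)) =
      four_block_mat (char_poly_matrix (list_mat F xs xs))
        (map_mat (\<lambda>a. [:- a:]) (list_mat F xs ys)) (0\<^sub>m ?m ?n)
        (char_poly_matrix (list_mat F ys ys))"
    unfolding char_poly_matrix_def list_mat_def
    by (rule eq_matI) (auto simp: nth_append assms)
  then have "char_poly (list_mat F (xs @ ys) (xs @ ys)) =
      char_poly (list_mat F xs xs) * char_poly (list_mat F ys ys)"
    unfolding char_poly_def by (simp add: det_four_block_mat_lower_left_zero[of _ ?n _ ?m])
  then show ?thesis by simp
qed

text \<open>
  Adding to the column of each representative the columns of the other members of its class makes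
  the matrix block triangular, with the quotient matrix as its first diagonal block.
\<close>

lemma char_poly_quotient_dvd:
  fixes F :: "'b \<Rightarrow> 'b \<Rightarrow> 'a :: field" and r :: "'b \<Rightarrow> 'b"
  assumes vs: "distinct vs" and rs: "distinct rs" "set rs = r ` set vs"
    and r: "\<And>x. x \<in> set vs \<Longrightarrow> r x \<in> set vs" "\<And>x. x \<in> set vs \<Longrightarrow> r (r x) = r x"
    and equitable: "\<And>x y. x \<in> set vs \<Longrightarrow> y \<in> set rs \<Longrightarrow>
      (\<Sum>z | z \<in> set vs \<and> r z = y. F x z) = (\<Sum>z | z \<in> set vs \<and> r z = y. F (r x) z)"
  shows "char_poly (list_mat (\<lambda>x y. \<Sum>z | z \<in> set vs \<and> r z = y. F x z) rs rs)
    dvd char_poly (list_mat F vs vs)"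
proof -
  define B where "B = (\<lambda>x y. \<Sum>z | z \<in> set vs \<and> r z = y. F x z)"
  \<comment> \<open>Listing the representatives first makes the quotient matrix the leading diagonal
    block.\<close>
  define ws where "ws = rs @ filter (\<lambda>x. x \<notin> set rs) vs"
  have rs_sub: "set rs \<subseteq> set vs" using r rs by auto
  have rs_iff: "x \<in> set rs \<longleftrightarrow> r x = x" if "x \<in> set vs" for x
    using that r rs by (auto simp: image_iff) metis
  have ws: "distinct ws" "set ws = set vs"
    using vs rs rs_sub by (auto simp: ws_def)
  have len: "length ws = length vs"
    using distinct_card[OF ws(1)] distinct_card[OF vs] ws(2) by simp
  \<comment> \<open>Column \<open>z\<close> of \<open>P\<close> is the indicator of the class of
    \<open>z\<close> if \<open>z\<close> is a representative, and the unit vector at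
    \<open>z\<close> otherwise. Row \<open>x\<close> is therefore the sum of the unit vectors at
    \<open>x\<close> and \<open>r x\<close>, or just the one at \<open>x\<close> if
    \<open>x = r x\<close>.\<close>
  define P :: "'b \<Rightarrow> 'b \<Rightarrow> 'a" where "P = (\<lambda>x z. of_bool (x = z \<or> z = r x))"
  \<comment> \<open>The inverse of \<open>P\<close>: since \<open>r x\<close> is itself a
    representative, subtracting its unit vector undoes the addition in row \<open>x\<close>.\<close>
  define Q :: "'b \<Rightarrow> 'b \<Rightarrow> 'a" where
    "Q = (\<lambda>x z. of_bool (x = z) - of_bool (z = r x \<and> x \<noteq> r x))"
  \<comment> \<open>The matrix of \<open>F\<close> in the new basis. Its zeros, in the rows of the
    other members and the columns of the representatives, are differences of class sums that
    equitability makes equal.\<close>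
  define T where "T = (\<lambda>x y. if y \<in> set rs then if x \<in> set rs then B x y else 0
    else F x y - of_bool (x \<noteq> r x) * F (r x) y)"
  have P_sum: "(\<Sum>z\<in>set vs. P x z * H z) = H x + of_bool (x \<noteq> r x) * H (r x)"
    if "x \<in> set vs" for x H
  proof -
    have "(\<Sum>z\<in>set vs. P x z * H z) =
        (\<Sum>z\<in>set vs. (if z = x then H x else 0) + (if z = r x then of_bool (x \<noteq> r x) * H (r x) else 0))"
      by (intro sum.cong) (auto simp: P_def)
    then show ?thesis using that r by (simp add: sum.distrib)
  qed
  have Q_sum: "(\<Sum>z\<in>set vs. Q x z * H z) = H x - of_bool (x \<noteq> r x) * H (r x)"
    if "x \<in> set vs" for x H
  proof -
    have "(\<Sum>z\<in>set vs. Q x z * H z) =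
        (\<Sum>z\<in>set vs. (if z = x then H x else 0) - (if z = r x then of_bool (x \<noteq> r x) * H (r x) else 0))"
      by (intro sum.cong) (auto simp: Q_def)
    then show ?thesis using that r by (simp add: sum_subtractf)
  qed
  have PQ: "list_mat P vs ws * list_mat Q ws vs = 1\<^sub>m (length vs)"
    unfolding list_mat_mult[OF ws(1)] list_mat_one[OF vs, symmetric] ws(2)
    by (rule list_mat_cong, subst P_sum) (auto simp: Q_def r)
  have QP: "list_mat Q ws vs * list_mat P vs ws = 1\<^sub>m (length vs)"
    unfolding list_mat_mult[OF vs] len[symmetric] list_mat_one[OF ws(1), symmetric]
    by (rule list_mat_cong, subst Q_sum) (auto simp: P_def r ws)
  have "list_mat F vs vs * list_mat P vs ws = list_mat P vs ws * list_mat T ws ws"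
    unfolding list_mat_mult[OF vs] list_mat_mult[OF ws(1)] ws(2)
  proof (rule list_mat_cong)
    fix x y assume x: "x \<in> set vs" and "y \<in> set ws"
    then have y: "y \<in> set vs" using ws by simp
    have "(\<Sum>z\<in>set vs. F x z * P z y) = (if y \<in> set rs then B x y else F x y)"
    proof (cases "y \<in> set rs")
      case True
      then have "(\<Sum>z\<in>set vs. F x z * P z y) = (\<Sum>z\<in>set vs. if r z = y then F x z else 0)"
        using rs_iff y by (intro sum.cong) (auto simp: P_def)
      then show ?thesis using True by (simp add: B_def sum.inter_filter)
    next
      case False
      then have "(\<Sum>z\<in>set vs. F x z * P z y) = (\<Sum>z\<in>set vs. if z = y then F x z else 0)"
        using rs by (intro sum.cong) (auto simp: P_def)
      then show ?thesis using False y by simp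
    qed
    also have "\<dots> = T x y + of_bool (x \<noteq> r x) * T (r x) y"
    proof (cases "x \<in> set rs")
      case True
      then show ?thesis using rs_iff[OF x] by (simp add: T_def)
    next
      case False
      moreover from False have "r x \<noteq> x" "r x \<in> set rs"
        using rs_iff[OF x] x rs by auto
      moreover have "B x y = B (r x) y" if "y \<in> set rs"
        unfolding B_def using x that by (rule equitable)
      ultimately show ?thesis
        using r(2)[OF x] by (simp add: T_def)
    qed
    also have "\<dots> = (\<Sum>z\<in>set vs. P x z * T z y)"
      by (simp only: P_sum[OF x])
    finally show "(\<Sum>z\<in>set vs. F x z * P z y) = (\<Sum>z\<in>set vs. P x z * T z y)" .
  qed
  then have "list_mat P vs ws * list_mat T ws ws * list_mat Q ws vs
      = list_mat F vs vs * (list_mat P vs ws * list_mat Q ws vs)"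
    by (metis assoc_mult_mat list_mat_carrier)
  also have "\<dots> = list_mat F vs vs"
    by (simp add: PQ right_mult_one_mat[OF list_mat_carrier])
  finally have "similar_mat (list_mat F vs vs) (list_mat T ws ws)"
    using PQ QP len list_mat_carrier[of _ ws ws] list_mat_carrier[of _ vs ws]
      list_mat_carrier[of _ ws vs]
    by (intro similar_matI[where n = "length vs" and P = "list_mat P vs ws" and Q = "list_mat Q ws vs"]) auto
  moreover have "list_mat B rs rs = list_mat T rs rs"
    by (rule list_mat_cong) (simp add: T_def)
  moreover have "char_poly (list_mat T rs rs) dvd char_poly (list_mat T ws ws)"
    unfolding ws_def by (rule char_poly_list_mat_block_dvd) (auto simp: T_def)
  ultimately show ?thesis
    by (simp add: B_def[symmetric] char_poly_similar)
qed

section \<open>Characteristic polynomials of symmetric matrices split over the reals\<close>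

text \<open>A polynomial of positive degree has a complex root, which is real by hypothesis and so
  splits off a real linear factor; the cofactor inherits the hypothesis.\<close>

lemma size_proots_eq_degree_real:
  fixes p :: "real poly"
  assumes "p \<noteq> 0" "\<And>z. poly (map_poly complex_of_real p) z = 0 \<Longrightarrow> z \<in> \<real>"
  shows "size (proots p) = degree p"
  using assms
proof (induction "degree p" arbitrary: p)
  case 0
  then show ?case using size_proots_le[of p] by simp
next
  case (Suc n)
  interpret of_real_poly_hom: map_poly_comm_ring_hom complex_of_real ..
  have "degree (map_poly complex_of_real p) = Suc n"
    using Suc.hyps(2) by simp
  then obtain z where "poly (map_poly complex_of_real p) z = 0"
    by (metis fundamental_theorem_of_algebra constant_degree nat.distinct(1))
  moreover from this obtain x where "z = complex_of_real x"
    using Suc.prems(2) by (auto elim: Reals_cases)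
  ultimately have "poly p x = 0" by simp
  then obtain q where pq: "p = [:- x, 1:] * q"
    using poly_eq_0_iff_dvd by (metis dvdE)
  have "q \<noteq> 0" using pq Suc.prems by auto
  then have "degree p = Suc (degree q)"
    unfolding pq by (subst degree_mult_eq) auto
  moreover have "map_poly complex_of_real p = map_poly complex_of_real [:- x, 1:] * map_poly complex_of_real q"
    unfolding pq by (rule of_real_poly_hom.hom_mult)
  ultimately have "size (proots q) = degree q"
    using Suc.hyps(2) Suc.prems \<open>q \<noteq> 0\<close> by (intro Suc.hyps(1)) auto
  then show ?case
    using \<open>degree p = _\<close> \<open>q \<noteq> 0\<close> unfolding pq by (subst proots_mult) auto
qed

text \<open>For a complex eigenvector \<open>v\<close> with eigenvalue \<open>z\<close>, the
  Hermitian form of \<open>A\<close> at \<open>v\<close> is \<open>z\<close> times the squared norm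
  \<open>S\<close> of \<open>v\<close>. Symmetry makes the form equal to its conjugate, and
  \<open>S\<close> is real and nonzero, so \<open>z\<close> is real.\<close>

lemma size_proots_char_poly_symmetric:
  fixes A :: "real mat"
  assumes A: "A \<in> carrier_mat n n" and sym: "\<And>i j. i < n \<Longrightarrow> j < n \<Longrightarrow> A $$ (i, j) = A $$ (j, i)"
  shows "size (proots (char_poly A)) = n"
proof -
  have "z \<in> \<real>" if "poly (map_poly complex_of_real (char_poly A)) z = 0" for z
  proof -
    let ?C = "map_mat complex_of_real A"
    have C: "?C \<in> carrier_mat n n" using A by simp
    have "poly (char_poly ?C) z = 0"
      using that by (simp add: of_real_hom.char_poly_hom[OF A])
    then obtain v where v: "v \<in> carrier_vec n" "v \<noteq> 0\<^sub>v n" "?C *\<^sub>v v = z \<cdot>\<^sub>v v"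
      using eigenvalue_root_char_poly[OF C] C by (auto simp: eigenvalue_def eigenvector_def)
    have eq: "(\<Sum>j<n. A $$ (i, j) * v $ j) = z * v $ i" if "i < n" for i
    proof -
      have "(?C *\<^sub>v v) $ i = (z \<cdot>\<^sub>v v) $ i" using v by simp
      then show ?thesis
        using that v(1) A by (simp add: scalar_prod_def atLeast0LessThan)
    qed
    define S where "S = (\<Sum>i<n. (norm (v $ i))\<^sup>2)"
    have "z * S = (\<Sum>i<n. cnj (v $ i) * (z * v $ i))"
      by (simp add: S_def sum_distrib_left complex_norm_square mult_ac flip: of_real_power)
    also have "\<dots> = (\<Sum>i<n. \<Sum>j<n. cnj (v $ i) * A $$ (i, j) * v $ j)"
      by (intro sum.cong) (simp_all add: eq[symmetric] sum_distrib_left mult_ac)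
    finally have zS: "z * S = (\<Sum>i<n. \<Sum>j<n. cnj (v $ i) * A $$ (i, j) * v $ j)" .
    have "cnj (z * S) = (\<Sum>i<n. \<Sum>j<n. v $ i * A $$ (i, j) * cnj (v $ j))"
      unfolding zS by simp
    also have "\<dots> = (\<Sum>j<n. \<Sum>i<n. v $ i * A $$ (i, j) * cnj (v $ j))"
      by (rule sum.swap)
    also have "\<dots> = z * S"
      unfolding zS by (intro sum.cong) (auto simp: sym mult_ac)
    finally have "cnj z * S = z * S" by simp
    moreover have "S \<noteq> 0"
    proof
      assume "S = 0"
      then have "\<forall>i<n. v $ i = 0"
        by (simp add: S_def sum_nonneg_eq_0_iff)
      then show False using v(1,2) by auto
    qed
    ultimately show "z \<in> \<real>" by (simp add: Reals_cnj_iff)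
  qed
  moreover have "degree (char_poly A) = n" "char_poly A \<noteq> 0"
    using degree_monic_char_poly[OF A] by auto
  ultimately show ?thesis using size_proots_eq_degree_real by metis
qed

text \<open>Numbers of roots and degrees both add up over a product, and no factor has more roots
  than its degree; equality for the product forces equality for each factor.\<close>

lemma size_proots_dvd:
  fixes p q :: "'a :: idom poly"
  assumes "q dvd p" "p \<noteq> 0" "size (proots p) = degree p"
  shows "size (proots q) = degree q"
proof -
  obtain r where p: "p = q * r" using assms(1) by (rule dvdE)
  then show ?thesis
    using assms(2,3) size_proots_le[of q] size_proots_le[of r]
    by (auto simp: proots_mult degree_mult_eq)
qed

lemma proots_subseteq_mset_dvd:
  fixes p q :: "'a :: idom poly"
  assumes "q dvd p" "p \<noteq> 0"
  shows "proots q \<subseteq># proots p"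
  using assms by (auto simp: proots_mult dvd_def)

section \<open>Positive eigenvectors of tridiagonal matrices\<close>

text \<open>The points of \<open>{a..M}\<close> where \<open>g\<close> is nonpositive form a
  nonempty compact set. Its greatest element is a zero, since a negative value there would force a
  later zero by the intermediate value theorem.\<close>

lemma last_zero_exists:
  fixes g :: "real \<Rightarrow> real"
  assumes cont: "continuous_on UNIV g" and "g a < 0" and pos: "\<And>x. x \<ge> M \<Longrightarrow> g x > 0"
  shows "\<exists>t>a. g t = 0 \<and> (\<forall>x>t. g x > 0)"
proof -
  define S where "S = {a..M} \<inter> {x. g x \<le> 0}"
  have le_M: "x \<le> M" if "g x \<le> 0" for x
    using pos[of x] that by (cases "x \<le> M") auto
  have "compact S"
    unfolding S_def by (intro compact_Int_closed closed_Collect_le cont continuous_on_const) simp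
  moreover have "a \<in> S" using assms(2) le_M[of a] by (simp add: S_def)
  ultimately obtain t where t: "t \<in> S" "\<And>x. x \<in> S \<Longrightarrow> x \<le> t"
    using compact_attains_sup[of S] by auto
  have upper: "g x > 0" if "x > t" for x
    using t that le_M[of x] by (fastforce simp: S_def not_less)
  have "g t = 0"
  proof (rule ccontr)
    assume "g t \<noteq> 0"
    then have "g t < 0" using t(1) by (simp add: S_def)
    moreover have "g (max M (t + 1)) > 0" by (intro pos) simp
    ultimately obtain x where "x \<ge> t" "g x = 0"
      using IVT'[of g t 0 "max M (t + 1)"] continuous_on_subset[OF cont] by force
    then show False using upper[of x] \<open>g t < 0\<close> by (cases x t rule: linorder_cases) auto
  qed
  then show ?thesis
    using upper assms(2) t(1) by (intro exI[of _ t]) (auto simp: S_def less_le)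
qed

text \<open>
  Entry \<open>i\<close> of the vector on which a tridiagonal matrix acts like the scalar \<open>x\<close> in its rows
  \<open>1, \<dots>, i - 1\<close>; here \<open>\<beta>\<close> is the superdiagonal and \<open>\<gamma>\<close> the subdiagonal.
\<close>

fun tridiag_vec :: "(nat \<Rightarrow> real) \<Rightarrow> (nat \<Rightarrow> real) \<Rightarrow> (nat \<Rightarrow> real) \<Rightarrow> nat \<Rightarrow> real \<Rightarrow> real" where
  "tridiag_vec \<alpha> \<beta> \<gamma> 0 x = 0"
| "tridiag_vec \<alpha> \<beta> \<gamma> (Suc 0) x = 1"
| "tridiag_vec \<alpha> \<beta> \<gamma> (Suc (Suc i)) x =
    ((x - \<alpha> (Suc i)) * tridiag_vec \<alpha> \<beta> \<gamma> (Suc i) x - \<gamma> (Suc i) * tridiag_vec \<alpha> \<beta> \<gamma> i x) / \<beta> (Suc i)"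

lemma continuous_on_tridiag_vec:
  assumes "\<And>i. \<beta> i > 0"
  shows "continuous_on UNIV (tridiag_vec \<alpha> \<beta> \<gamma> i)"
proof (induction i rule: induct_nat_012)
  case (ge2 i)
  have "\<beta> (Suc i) \<noteq> 0" using assms[of "Suc i"] by simp
  then show ?case
    using ge2 by (auto intro!: continuous_intros)
qed auto

text \<open>For large \<open>x\<close> the factor \<open>x - \<alpha> i\<close> exceeds
  \<open>\<beta> i + \<gamma> i\<close>, so the entries increase weakly with the index. The
  induction carries this monotonicity in order to bound the subtracted term of the recurrence by the
  preceding entry.\<close>

lemma tridiag_vec_eventually_pos:
  assumes "\<And>i. \<beta> i > 0" "\<And>i. \<gamma> i > 0"
  shows "\<exists>M. \<forall>x\<ge>M. 0 \<le> tridiag_vec \<alpha> \<beta> \<gamma> i x \<and> tridiag_vec \<alpha> \<beta> \<gamma> i x \<le> tridiag_vec \<alpha> \<beta> \<gamma> (Suc i) x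
    \<and> 0 < tridiag_vec \<alpha> \<beta> \<gamma> (Suc i) x"
proof (induction i)
  case (Suc i)
  let ?f = "tridiag_vec \<alpha> \<beta> \<gamma>" and ?j = "Suc i"
  obtain M where M: "\<And>x. x \<ge> M \<Longrightarrow> 0 \<le> ?f i x \<and> ?f i x \<le> ?f ?j x \<and> 0 < ?f ?j x"
    using Suc by blast
  have "?f ?j x \<le> ?f (Suc ?j) x" if "x \<ge> max M (\<alpha> ?j + \<beta> ?j + \<gamma> ?j)" for x
  proof -
    have "\<beta> ?j * ?f ?j x \<le> (x - \<alpha> ?j - \<gamma> ?j) * ?f ?j x"
      using M[of x] that by (intro mult_right_mono) auto
    also have "\<dots> \<le> (x - \<alpha> ?j) * ?f ?j x - \<gamma> ?j * ?f i x"
      using M[of x] that assms(2)[of ?j] by (simp add: algebra_simps)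
    finally show ?thesis
      using assms(1)[of ?j] by (simp add: field_simps)
  qed
  then have "\<forall>x\<ge>max M (\<alpha> ?j + \<beta> ?j + \<gamma> ?j). 0 \<le> ?f ?j x \<and> ?f ?j x \<le> ?f (Suc ?j) x
    \<and> 0 < ?f (Suc ?j) x"
    using M by (smt (verit) max.boundedE)
  then show ?case by blast
qed auto

text \<open>At the last zero of an entry the next entry is negative, so the last zeros increase.\<close>

lemma tridiag_vec_last_zero:
  assumes "\<And>i. \<beta> i > 0" "\<And>i. \<gamma> i > 0"
  shows "\<exists>t. tridiag_vec \<alpha> \<beta> \<gamma> (Suc (Suc n)) t = 0 \<and>
    (\<forall>x>t. tridiag_vec \<alpha> \<beta> \<gamma> (Suc (Suc n)) x > 0) \<and>
    (\<forall>x\<ge>t. \<forall>i\<in>{1..Suc n}. tridiag_vec \<alpha> \<beta> \<gamma> i x > 0)"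
proof (induction n)
  case 0
  \<comment> \<open>Entry 2 is \<open>(x - \<alpha> 1) / \<beta> 1\<close>, because entry 0
    vanishes.\<close>
  show ?case using assms(1)[of 1] by (intro exI[of _ "\<alpha> 1"]) auto
next
  case (Suc n)
  let ?f = "tridiag_vec \<alpha> \<beta> \<gamma>"
  obtain s where s: "?f (Suc (Suc n)) s = 0" "\<And>x. x > s \<Longrightarrow> ?f (Suc (Suc n)) x > 0"
    "\<And>x i. x \<ge> s \<Longrightarrow> i \<in> {1..Suc n} \<Longrightarrow> ?f i x > 0"
    using Suc by blast
  have "?f (Suc (Suc (Suc n))) s = - (\<gamma> (Suc (Suc n)) * ?f (Suc n) s / \<beta> (Suc (Suc n)))"
    by (subst tridiag_vec.simps(3)) (simp add: s(1) del: tridiag_vec.simps)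
  also have "\<dots> < 0"
    using s(3)[of s "Suc n"] assms by simp
  finally have neg: "?f (Suc (Suc (Suc n))) s < 0" .
  obtain M where "\<And>x. x \<ge> M \<Longrightarrow> ?f (Suc (Suc (Suc n))) x > 0"
    using tridiag_vec_eventually_pos[where i = "Suc (Suc n)" and \<alpha> = \<alpha>
      and \<beta> = \<beta> and \<gamma> = \<gamma>, OF assms] by blast
  then obtain t where t: "t > s" "?f (Suc (Suc (Suc n))) t = 0"
      "\<And>x. x > t \<Longrightarrow> ?f (Suc (Suc (Suc n))) x > 0"
    using last_zero_exists[OF continuous_on_tridiag_vec neg] assms(1) by metis
  have "?f i x > 0" if "x \<ge> t" "i \<in> {1..Suc (Suc n)}" for x i
    using s(2,3)[of x] t(1) that by (cases "i = Suc (Suc n)") auto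
  then show ?case using t(2,3) by blast
qed

text \<open>The value \<open>t\<close> is the last zero of entry \<open>d + 1\<close>. There the
  recurrence closes up in row \<open>d\<close>, while the entries \<open>1, ..., d\<close> are still
  positive.\<close>

lemma tridiag_pos_eigenvector:
  fixes \<alpha> \<beta> \<gamma> :: "nat \<Rightarrow> real"
  assumes "\<And>i. 1 \<le> i \<Longrightarrow> i < d \<Longrightarrow> \<beta> i > 0" "\<And>i. 1 < i \<Longrightarrow> i \<le> d \<Longrightarrow> \<gamma> i > 0" "d \<ge> 1"
  obtains t w where "w 0 = 0" "w (Suc d) = 0" "\<And>i. i \<in> {1..d} \<Longrightarrow> w i > 0"
    "\<And>i. i \<in> {1..d} \<Longrightarrow> \<alpha> i * w i + \<beta> i * w (i + 1) + \<gamma> i * w (i - 1) = t * w i"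
proof -
  \<comment> \<open>The recurrence divides by the superdiagonal, and the lemma on last zeros wants
    both sequences positive everywhere. Hence the default value 1 outside the range of the
    assumptions.\<close>
  define \<beta>' where "\<beta>' = (\<lambda>i. if 1 \<le> i \<and> i < d then \<beta> i else 1)"
  define \<gamma>' where "\<gamma>' = (\<lambda>i. if 1 < i \<and> i \<le> d then \<gamma> i else 1)"
  let ?f = "tridiag_vec \<alpha> \<beta>' \<gamma>'"
  have pos: "\<beta>' i > 0" "\<gamma>' i > 0" for i using assms by (auto simp: \<beta>'_def \<gamma>'_def)
  obtain n where d: "d = Suc n" using assms(3) by (cases d) auto
  obtain t where t: "?f (Suc d) t = 0" "\<And>i. i \<in> {1..d} \<Longrightarrow> ?f i t > 0"
    using tridiag_vec_last_zero[of \<beta>' \<gamma>' \<alpha> n] pos unfolding d by blast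
  show thesis
  proof (rule that[of "\<lambda>i. ?f i t" t])
    fix i assume i: "i \<in> {1..d}"
    then obtain j where j: "i = Suc j" by (cases i) auto
    have "\<beta>' i * ?f (Suc i) t = (t - \<alpha> i) * ?f i t - \<gamma>' i * ?f j t"
      using pos(1)[of i] unfolding j by simp
    \<comment> \<open>The modified coefficients can differ from the given ones only in row
      \<open>d\<close> for \<open>\<beta>\<close> and in row 1 for \<open>\<gamma>\<close>, where
      they are multiplied by entry \<open>d + 1\<close> or entry 0, which is zero.\<close>
    moreover have "\<beta>' i * ?f (Suc i) t = \<beta> i * ?f (Suc i) t"
      using i t(1) by (cases "i = d") (auto simp: \<beta>'_def)
    moreover have "\<gamma>' i * ?f j t = \<gamma> i * ?f j t"
      using i j by (cases j) (auto simp: \<gamma>'_def)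
    ultimately have "\<beta> i * ?f (Suc i) t = (t - \<alpha> i) * ?f i t - \<gamma> i * ?f j t" by simp
    then show "\<alpha> i * ?f i t + \<beta> i * ?f (i + 1) t + \<gamma> i * ?f (i - 1) t = t * ?f i t"
      using j by (simp add: algebra_simps del: tridiag_vec.simps)
  qed (use t in auto)
qed

section \<open>A Perron-Frobenius type bound\<close>

text \<open>In the row \<open>i\<close> where \<open>\<bar>v $ i\<bar> / w i\<close> is greatest for
  an eigenvector \<open>v\<close>, the triangle inequality bounds \<open>\<bar>k\<bar>\<close> by
  \<open>t\<close>. Absolute values of the entries allow matrices with negative entries, such as a
  Laplacian.\<close>

lemma eigenvalue_le_of_pos_vector:
  fixes A :: "real mat"
  assumes A: "A \<in> carrier_mat n n" and "eigenvalue A k"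
    and w: "\<And>i. i < n \<Longrightarrow> w i > 0"
    and le: "\<And>i. i < n \<Longrightarrow> (\<Sum>j<n. \<bar>A $$ (i, j)\<bar> * w j) \<le> t * w i"
  shows "k \<le> t"
proof -
  obtain v where v: "v \<in> carrier_vec n" "v \<noteq> 0\<^sub>v n" "A *\<^sub>v v = k \<cdot>\<^sub>v v"
    using assms(2) A by (auto simp: eigenvalue_def eigenvector_def)
  define q where "q = (\<lambda>i. \<bar>v $ i\<bar> / w i)"
  obtain l where l: "l < n" "v $ l \<noteq> 0"
  proof (rule ccontr)
    assume "\<not> thesis"
    then have "v = 0\<^sub>v n" using that v(1) by (intro eq_vecI) auto
    then show False using v(2) by simp
  qed
  obtain i where i: "i < n" "\<And>j. j < n \<Longrightarrow> q j \<le> q i"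
    using Max_in[of "q ` {..<n}"] Max_ge[of "q ` {..<n}"] l(1)
    by (metis (no_types, lifting) empty_iff finite_imageI finite_lessThan imageE image_eqI lessThan_iff)
  have "q l > 0" using l w[of l] by (simp add: q_def)
  then have "q i > 0" using i(2)[OF l(1)] by simp
  have v_le: "\<bar>v $ j\<bar> \<le> q i * w j" if "j < n" for j
    using i(2)[OF that] w[OF that] by (simp add: q_def field_simps)
  have vi: "\<bar>v $ i\<bar> = q i * w i" using w[OF i(1)] by (simp add: q_def)
  have "(A *\<^sub>v v) $ i = (k \<cdot>\<^sub>v v) $ i" using v by simp
  then have "k * v $ i = (\<Sum>j<n. A $$ (i, j) * v $ j)"
    using i(1) v(1) A by (simp add: scalar_prod_def atLeast0LessThan)
  then have "\<bar>k\<bar> * \<bar>v $ i\<bar> \<le> (\<Sum>j<n. \<bar>A $$ (i, j)\<bar> * \<bar>v $ j\<bar>)"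
    by (metis (no_types, lifting) abs_mult sum_abs sum.cong)
  also have "\<dots> \<le> (\<Sum>j<n. \<bar>A $$ (i, j)\<bar> * (q i * w j))"
    using v_le by (intro sum_mono mult_left_mono) auto
  also have "\<dots> = q i * (\<Sum>j<n. \<bar>A $$ (i, j)\<bar> * w j)"
    by (simp add: sum_distrib_left mult_ac)
  also have "\<dots> \<le> q i * (t * w i)"
    using le[OF i(1)] \<open>q i > 0\<close> by simp
  finally have "\<bar>k\<bar> * (q i * w i) \<le> t * (q i * w i)" by (simp add: vi mult_ac)
  then have "\<bar>k\<bar> \<le> t"
    using \<open>q i > 0\<close> w[OF i(1)] by (simp add: mult_le_cancel_right)
  then show ?thesis by simp
qed

section \<open>Spectra of equitable partitions\<close>

text \<open>One chosen representative per class number turns the labelling \<open>cl\<close> into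
  the idempotent map \<open>rep \<circ> cl\<close>. Listing the representatives by class number
  gives the quotient matrix its rows and columns in the order \<open>1, ..., d\<close>.\<close>

lemma char_poly_equitable_dvd:
  fixes F :: "'b \<Rightarrow> 'b \<Rightarrow> 'a :: field" and cl :: "'b \<Rightarrow> nat"
  assumes vs: "distinct vs" and cl: "cl ` set vs = {1..d}"
    and equitable: "\<And>x j. x \<in> set vs \<Longrightarrow> j \<in> {1..d} \<Longrightarrow>
      (\<Sum>y | y \<in> set vs \<and> cl y = j. F x y) = B (cl x) j"
  shows "char_poly (mat d d (\<lambda>(i, j). B (i + 1) (j + 1))) dvd char_poly (list_mat F vs vs)"
proof -
  define rep where "rep = (\<lambda>i. SOME x. x \<in> set vs \<and> cl x = i)"
  have rep: "rep i \<in> set vs" "cl (rep i) = i" if "i \<in> {1..d}" for i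
    using someI_ex[of "\<lambda>x. x \<in> set vs \<and> cl x = i"] that unfolding rep_def cl[symmetric] by auto
  have clD: "cl x \<in> {1..d}" if "x \<in> set vs" for x using that cl by blast
  define rs where "rs = map rep [1..<Suc d]"
  have rs: "distinct rs" "set rs = (rep \<circ> cl) ` set vs"
  proof -
    have "inj_on rep {1..d}" using rep(2) by (metis inj_onI)
    then show "distinct rs" by (simp add: rs_def distinct_map atLeastLessThanSuc_atLeastAtMost del: upt_Suc)
    show "set rs = (rep \<circ> cl) ` set vs"
      unfolding image_comp[symmetric] cl by (simp add: rs_def atLeastLessThanSuc_atLeastAtMost del: upt_Suc)
  qed
  have class_eq: "{z. z \<in> set vs \<and> (rep \<circ> cl) z = rep j} = {z. z \<in> set vs \<and> cl z = j}"
    if "j \<in> {1..d}" for j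
    using rep(2) clD that by (auto simp: o_def) metis
  have "list_mat (\<lambda>x y. \<Sum>z | z \<in> set vs \<and> (rep \<circ> cl) z = y. F x z) rs rs =
      mat d d (\<lambda>(i, j). B (i + 1) (j + 1))"
  proof (rule eq_matI)
    fix i j assume "i < dim_row (mat d d (\<lambda>(i, j). B (i + 1) (j + 1)))"
      "j < dim_col (mat d d (\<lambda>(i, j). B (i + 1) (j + 1)))"
    then have ij: "i < d" "j < d" by auto
    have "rs ! i = rep (i + 1)" "rs ! j = rep (j + 1)"
      using ij by (auto simp: rs_def nth_append simp del: upt_Suc)
    moreover have "(\<Sum>z | z \<in> set vs \<and> (rep \<circ> cl) z = rep (j + 1). F (rep (i + 1)) z) = B (i + 1) (j + 1)"
      using ij equitable[OF rep(1), of "i + 1" "j + 1"] rep(2)[of "i + 1"] by (subst class_eq) auto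
    ultimately show "list_mat (\<lambda>x y. \<Sum>z | z \<in> set vs \<and> (rep \<circ> cl) z = y. F x z) rs rs $$ (i, j) =
      mat d d (\<lambda>(i, j). B (i + 1) (j + 1)) $$ (i, j)"
      using ij by (simp add: list_mat_def) (simp add: rs_def)
  qed (auto simp: list_mat_def rs_def)
  moreover have "char_poly (list_mat (\<lambda>x y. \<Sum>z | z \<in> set vs \<and> (rep \<circ> cl) z = y. F x z) rs rs)
    dvd char_poly (list_mat F vs vs)"
  proof (rule char_poly_quotient_dvd[OF vs rs])
    fix x y assume x: "x \<in> set vs" and "y \<in> set rs"
    then obtain j where j: "j \<in> {1..d}" and y: "y = rep j" using rs(2) clD by auto
    show "(\<Sum>z | z \<in> set vs \<and> (rep \<circ> cl) z = y. F x z) =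
        (\<Sum>z | z \<in> set vs \<and> (rep \<circ> cl) z = y. F ((rep \<circ> cl) x) z)"
      unfolding y class_eq[OF j] using x j rep clD by (simp add: equitable)
  qed (use rep clD in auto)
  ultimately show ?thesis by simp
qed

text \<open>Symmetry makes the characteristic polynomial of the full matrix split, so its divisor,
  that of the quotient, splits too. Eigenvalues are thus compared with their multiplicities.\<close>

lemma equitable_eigenvalues_mset:
  fixes F :: "'b \<Rightarrow> 'b \<Rightarrow> real"
  assumes "distinct vs" "cl ` set vs = {1..d}"
    and "\<And>x y. x \<in> set vs \<Longrightarrow> y \<in> set vs \<Longrightarrow> F x y = F y x"
    and "\<And>x j. x \<in> set vs \<Longrightarrow> j \<in> {1..d} \<Longrightarrow>
      (\<Sum>y | y \<in> set vs \<and> cl y = j. F x y) = B (cl x) j"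
  shows "size (eigenvalues_mset (mat d d (\<lambda>(i, j). B (i + 1) (j + 1)))) = d"
    and "eigenvalues_mset (mat d d (\<lambda>(i, j). B (i + 1) (j + 1)))
      \<subseteq># eigenvalues_mset (list_mat F vs vs)"
proof -
  let ?B = "mat d d (\<lambda>(i, j). B (i + 1) (j + 1))"
  have dvd: "char_poly ?B dvd char_poly (list_mat F vs vs)"
    using assms(1,2,4) by (rule char_poly_equitable_dvd)
  have "size (proots (char_poly (list_mat F vs vs))) = length vs"
    by (rule size_proots_char_poly_symmetric[OF list_mat_carrier])
      (simp add: list_mat_def assms(3))
  moreover have "degree (char_poly (list_mat F vs vs)) = length vs"
    "char_poly (list_mat F vs vs) \<noteq> 0"
    using degree_monic_char_poly[OF list_mat_carrier[of F vs vs]] by auto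
  moreover have "degree (char_poly ?B) = d"
    using degree_monic_char_poly[of ?B d] by simp
  ultimately show "size (eigenvalues_mset ?B) = d"
    and "eigenvalues_mset ?B \<subseteq># eigenvalues_mset (list_mat F vs vs)"
    using size_proots_dvd[OF dvd] proots_subseteq_mset_dvd[OF dvd]
    by (auto simp: eigenvalues_mset_def)
qed

text \<open>Here \<open>C\<close> is the quotient of the entrywise absolute value of
  \<open>F\<close>. Its positive eigenvector \<open>w\<close>, made constant on classes, bounds
  every eigenvalue of \<open>F\<close> by \<open>t\<close>; the vector \<open>u\<close> shows that
  \<open>t\<close> is an eigenvalue of \<open>B\<close>, hence of \<open>F\<close>. Separate vectors
  allow \<open>B\<close> and \<open>C\<close> to differ in signs.\<close>

lemma equitable_largest_eigenvalue:
  fixes F :: "'b \<Rightarrow> 'b \<Rightarrow> real"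
  assumes vs: "distinct vs" "cl ` set vs = {1..d}"
    and equitable: "\<And>x j. x \<in> set vs \<Longrightarrow> j \<in> {1..d} \<Longrightarrow>
      (\<Sum>y | y \<in> set vs \<and> cl y = j. F x y) = B (cl x) j"
    and abs_sum: "\<And>x j. x \<in> set vs \<Longrightarrow> j \<in> {1..d} \<Longrightarrow>
      (\<Sum>y | y \<in> set vs \<and> cl y = j. \<bar>F x y\<bar>) = C (cl x) j"
    and w: "\<And>i. i \<in> {1..d} \<Longrightarrow> w i > 0"
      "\<And>i. i \<in> {1..d} \<Longrightarrow> (\<Sum>j\<in>{1..d}. C i j * w j) = t * w i"
    and u: "\<And>i. i \<in> {1..d} \<Longrightarrow> (\<Sum>j\<in>{1..d}. B i j * u j) = t * u i"
      "k \<in> {1..d}" "u k \<noteq> 0"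
  shows "largest_eigenvalue (list_mat F vs vs) =
    largest_eigenvalue (mat d d (\<lambda>(i, j). B (i + 1) (j + 1)))"
proof -
  let ?A = "list_mat F vs vs" and ?B = "mat d d (\<lambda>(i, j). B (i + 1) (j + 1))"
  have B: "?B \<in> carrier_mat d d" by simp
  have clD: "cl x \<in> {1..d}" if "x \<in> set vs" for x using that vs(2) by blast
  have "?B *\<^sub>v vec d (\<lambda>i. u (i + 1)) = t \<cdot>\<^sub>v vec d (\<lambda>i. u (i + 1))"
  proof (rule eq_vecI)
    fix i assume "i < dim_vec (t \<cdot>\<^sub>v vec d (\<lambda>i. u (i + 1)))"
    then have i: "i < d" by simp
    have "(\<Sum>j<d. B (i + 1) (j + 1) * u (j + 1)) = (\<Sum>j\<in>{1..d}. B (i + 1) j * u j)"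
      using sum.atLeast1_atMost_eq[of "\<lambda>j. B (i + 1) j * u j" d] by simp
    then show "(?B *\<^sub>v vec d (\<lambda>i. u (i + 1))) $ i = (t \<cdot>\<^sub>v vec d (\<lambda>i. u (i + 1))) $ i"
      using i u(1)[of "i + 1"] by (simp add: scalar_prod_def atLeast0LessThan)
  qed simp
  moreover have "vec d (\<lambda>i. u (i + 1)) \<noteq> 0\<^sub>v d"
  proof
    assume "vec d (\<lambda>i. u (i + 1)) = 0\<^sub>v d"
    then have "vec d (\<lambda>i. u (i + 1)) $ (k - 1) = 0\<^sub>v d $ (k - 1)" by simp
    then show False using u(2,3) by auto
  qed
  ultimately have "eigenvalue ?B t"
    unfolding eigenvalue_def eigenvector_def by (intro exI[of _ "vec d (\<lambda>i. u (i + 1))"]) simp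
  have spectrum_sub: "spectrum ?B \<subseteq> spectrum ?A"
  proof
    fix s assume "s \<in> spectrum ?B"
    then have "poly (char_poly ?B) s = 0" using eigenvalue_root_char_poly[OF B] by (simp add: spectrum_def)
    then have "poly (char_poly ?A) s = 0"
      using char_poly_equitable_dvd[where B = B and cl = cl, OF vs equitable] by (auto simp: dvd_def)
    then show "s \<in> spectrum ?A"
      using eigenvalue_root_char_poly[OF list_mat_carrier[of F vs vs]] by (simp add: spectrum_def)
  qed
  have le: "s \<le> t" if "s \<in> spectrum ?A" for s
  proof (rule eigenvalue_le_of_pos_vector[OF list_mat_carrier])
    show "eigenvalue ?A s" using that by (simp add: spectrum_def)
    show "w (cl (vs ! i)) > 0" if "i < length vs" for i using that clD w(1) by simp
    fix i assume i: "i < length vs"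
    define x where "x = vs ! i"
    have x: "x \<in> set vs" using i by (simp add: x_def)
    have "(\<Sum>j<length vs. \<bar>?A $$ (i, j)\<bar> * w (cl (vs ! j))) = (\<Sum>y\<in>set vs. \<bar>F x y\<bar> * w (cl y))"
      using i by (simp add: list_mat_def x_def sum_set_conv_nth[OF vs(1), symmetric])
    also have "\<dots> = (\<Sum>j\<in>{1..d}. \<Sum>y | y \<in> set vs \<and> cl y = j. \<bar>F x y\<bar> * w (cl y))"
      using vs(2) by (intro sum.group[symmetric]) auto
    also have "\<dots> = (\<Sum>j\<in>{1..d}. C (cl x) j * w j)"
      by (intro sum.cong) (simp_all add: abs_sum[OF x, symmetric] sum_distrib_right)
    also have "\<dots> = t * w (cl x)" by (rule w(2)[OF clD[OF x]])
    finally show "(\<Sum>j<length vs. \<bar>?A $$ (i, j)\<bar> * w (cl (vs ! j))) \<le> t * w (cl (vs ! i))"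
      by (simp add: x_def)
  qed
  have "finite (spectrum ?A)"
    using card_finite_spectrum(1)[OF list_mat_carrier] .
  moreover have "t \<in> spectrum ?B" using \<open>eigenvalue ?B t\<close> by (simp add: spectrum_def)
  ultimately have "Max (spectrum ?A) = t" "Max (spectrum ?B) = t"
    using le spectrum_sub finite_subset[OF spectrum_sub] by (auto intro!: Max_eqI)
  then show ?thesis by (simp add: largest_eigenvalue_def)
qed

text \<open>The zero boundary values let the sum run over \<open>0, ..., d + 1\<close> instead, so
  that the first and last rows need no separate formula.\<close>

lemma sum_tridiagonal:
  fixes w :: "nat \<Rightarrow> 'a :: comm_ring_1"
  assumes i: "i \<in> {1..d}" and w: "w 0 = 0" "w (Suc d) = 0"
  shows "(\<Sum>j\<in>{1..d}. (if i = j then x else if j = i + 1 then y else if i = j + 1 then z else 0) * w j)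
    = x * w i + y * w (i + 1) + z * w (i - 1)"
proof -
  let ?h = "\<lambda>j. (if j = i then x * w i else 0) + (if j = i + 1 then y * w (i + 1) else 0) +
    (if j = i - 1 then z * w (i - 1) else 0)"
  have "(\<Sum>j\<in>{1..d}. (if i = j then x else if j = i + 1 then y else if i = j + 1 then z else 0) * w j)
      = (\<Sum>j\<in>{1..d}. ?h j)"
    using i by (intro sum.cong) auto
  also have "\<dots> = (\<Sum>j\<in>{0..Suc d}. ?h j)"
    using i w by (cases "i = d") (auto intro!: sum.mono_neutral_left simp: le_Suc_eq)
  also have "\<dots> = x * w i + y * w (i + 1) + z * w (i - 1)"
    using i w by (cases "i = d") (auto simp: sum.distrib)
  finally show ?thesis .
qed

section \<open>Distances and token graphs\<close>

text \<open>The description is meaningful only where \<open>gdist\<close> is a finite natural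
  number, as it is between vertices of a connected graph.\<close>

definition ndist :: "'a pair_pre_digraph \<Rightarrow> 'a \<Rightarrow> 'a \<Rightarrow> nat" where
  "ndist G u v = (THE k. gdist G u v = ereal (real k))"

lemma ndist_eqI: "gdist G u v = ereal (real k) \<Longrightarrow> ndist G u v = k"
  by (auto simp: ndist_def)

locale connected_pair_graph = pair_graph +
  assumes is_connected: "Digraph_Component.connected (with_proj G)"
begin

text \<open>Connectedness is defined through the symmetric closure of the digraph, which is the
  graph itself because its arcs are symmetric.\<close>

lemma reachable_verts:
  assumes "u \<in> pverts G" "v \<in> pverts G"
  shows "u \<rightarrow>\<^sup>*\<^bsub>with_proj G\<^esub> v"
proof -
  have "parcs (mk_symmetric (with_proj G)) = parcs G"
    by (auto simp: mk_symmetric_def dest: arcs_symmetric)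
  then have "mk_symmetric (with_proj G) = G"
    by (intro pair_pre_digraph.equality) (auto simp: mk_symmetric_def)
  then show ?thesis
    using is_connected assms by (auto simp: Digraph_Component.connected_def strongly_connected_def)
qed

lemma awalk_cost_const: "awalk_cost (\<lambda>_. 1) p = real (length p)"
  by (induction p) auto

lemma shortest_awalk:
  assumes "u \<in> pverts G" "v \<in> pverts G"
  obtains p where "awalk u p v" "length p = ndist G u v" "gdist G u v = ereal (real (ndist G u v))"
proof -
  obtain p where p: "apath u p v" "gdist G u v = ereal (real (length p))"
    using min_cost_awalk[OF reachable_verts[OF assms], of "\<lambda>_. 1"]
    by (auto simp: gdist_def awalk_cost_const)
  moreover have "awalk u p v" using p(1) by (rule awalkI_apath)
  ultimately show thesis using ndist_eqI[OF p(2)] that by auto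
qed

lemma gdist_eq_ndist:
  assumes "u \<in> pverts G" "v \<in> pverts G"
  shows "gdist G u v = ereal (real (ndist G u v))"
  using assms by (rule shortest_awalk)

lemma gdist_eq_iff:
  assumes "u \<in> pverts G" "v \<in> pverts G"
  shows "gdist G u v = ereal x \<longleftrightarrow> real (ndist G u v) = x"
  using gdist_eq_ndist[OF assms] by auto

lemma ndist_le_length:
  assumes "awalk u p v"
  shows "ndist G u v \<le> length p"
proof -
  have "u \<in> pverts G" "v \<in> pverts G" using assms by auto
  then show ?thesis
    using min_cost_le_walk_cost[OF assms, of "\<lambda>_. 1"] gdist_eq_ndist
    by (auto simp: gdist_def awalk_cost_const)
qed

lemma ndist_self [simp]:
  assumes "u \<in> pverts G"
  shows "ndist G u u = 0"
  using ndist_le_length[of u "[]" u] assms by (simp add: awalk_Nil_iff)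

lemma ndist_eq_0_iff:
  assumes "u \<in> pverts G" "v \<in> pverts G"
  shows "ndist G u v = 0 \<longleftrightarrow> u = v"
proof
  assume 0: "ndist G u v = 0"
  obtain p where "awalk u p v" "length p = ndist G u v"
    using assms by (rule shortest_awalk)
  then show "u = v" using 0 by (simp add: awalk_Nil_iff)
qed (simp add: assms)

lemma ndist_commute:
  assumes "u \<in> pverts G" "v \<in> pverts G"
  shows "ndist G u v = ndist G v u"
proof -
  have len: "length (rev_path p) = length p" for p :: "('a \<times> 'a) list"
    by (induction p) auto
  have "ndist G x y \<le> ndist G y x" if xy: "x \<in> pverts G" "y \<in> pverts G" for x y
  proof -
    obtain p where "awalk y p x" "length p = ndist G y x"
      using xy(2,1) by (rule shortest_awalk)
    then show ?thesis using ndist_le_length[of x "rev_path p" y] len[of p] by simp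
  qed
  then show ?thesis using assms by (intro antisym)
qed

lemma ndist_arc_le:
  assumes u: "u \<in> pverts G" and vw: "(v, w) \<in> parcs G"
  shows "ndist G u w \<le> ndist G u v + 1"
proof -
  have v: "v \<in> pverts G" using vw by (rule in_arcsD1)
  obtain p where p: "awalk u p v" "length p = ndist G u v"
    using u v by (rule shortest_awalk)
  have "awalk v [(v, w)] w"
    using vw in_arcsD2[OF vw] by (simp add: awalk_simps)
  then have "awalk u (p @ [(v, w)]) w" using p(1) by (rule awalk_appendI[rotated])
  then have "ndist G u w \<le> length (p @ [(v, w)])" by (rule ndist_le_length)
  then show ?thesis using p(2) by simp
qed

text \<open>Dropping the last arc of a shortest walk leaves a walk of length \<open>k\<close>, and
  \<open>ndist_arc_le\<close> forbids a shorter one.\<close>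

lemma ndist_predecessor:
  assumes u: "u \<in> pverts G" and v: "v \<in> pverts G" and "ndist G u v = Suc k"
  obtains w where "(w, v) \<in> parcs G" "ndist G u w = k"
proof -
  obtain p where p: "awalk u p v" "length p = Suc k"
    using shortest_awalk[OF u v] assms(3) by auto
  then obtain p' e where pe: "p = p' @ [e]" by (metis length_Suc_conv_rev)
  then obtain w where w: "awalk u p' w" "awalk w [e] v"
    using p(1) by auto
  then have "(w, v) \<in> parcs G" by (cases e) (auto simp: awalk_simps)
  moreover have "ndist G u w \<le> k" using ndist_le_length[OF w(1)] p(2) pe by simp
  moreover have "Suc k \<le> ndist G u w + 1"
    using ndist_arc_le[OF u \<open>(w, v) \<in> parcs G\<close>] assms(3) by simp
  ultimately show thesis using that by simp
qed

lemma even_length_awalk_bipartite: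
  assumes "X \<union> Y = pverts G" "X \<inter> Y = {}" "parcs G \<subseteq> X \<times> Y \<union> Y \<times> X" "awalk u p v"
  shows "even (length p) \<longleftrightarrow> (u \<in> X \<longleftrightarrow> v \<in> X)"
  using assms(4)
proof (induction p arbitrary: u)
  case Nil
  then show ?case by (simp add: awalk_Nil_iff)
next
  case (Cons e p)
  obtain x y where e: "e = (x, y)" by (cases e)
  with Cons.prems have "x = u" "(u, y) \<in> parcs G" "awalk y p v"
    by (auto simp: awalk_Cons_iff)
  then show ?case using Cons.IH[of y] assms(2,3) by auto
qed

text \<open>The parity of the distance from \<open>u\<close> tells the side of a vertex, and every
  arc changes sides.\<close>

lemma bipartite_arc_ndist_neq:
  assumes "bipartite G" and u: "u \<in> pverts G" and vw: "(v, w) \<in> parcs G"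
  shows "ndist G u v \<noteq> ndist G u w"
proof -
  obtain X Y where XY: "X \<union> Y = pverts G" "X \<inter> Y = {}" "parcs G \<subseteq> X \<times> Y \<union> Y \<times> X"
    using assms(1) by (auto simp: bipartite_def)
  have "even (ndist G u x) \<longleftrightarrow> (u \<in> X \<longleftrightarrow> x \<in> X)" if x: "x \<in> pverts G" for x
  proof -
    obtain p where "awalk u p x" "length p = ndist G u x"
      using u x by (rule shortest_awalk)
    then show ?thesis using even_length_awalk_bipartite[OF XY, of u p x] by simp
  qed
  then have "even (ndist G u v) \<noteq> even (ndist G u w)"
    using XY(2,3) vw in_arcsD1[OF vw] in_arcsD2[OF vw] by auto
  then show ?thesis by auto
qed

section \<open>Adjacency in the token graph as the move of one token\<close>

lemma token_graph2_arc_iff: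
  assumes "u \<in> pverts G" "v \<in> pverts G" "u \<noteq> v"
  shows "({u, v}, B) \<in> parcs (token_graph2 G) \<longleftrightarrow>
    (\<exists>w. (u, w) \<in> parcs G \<and> w \<noteq> v \<and> B = {w, v}) \<or> (\<exists>w. (v, w) \<in> parcs G \<and> w \<noteq> u \<and> B = {u, w})"
proof
  assume "({u, v}, B) \<in> parcs (token_graph2 G)"
  then obtain a b where B: "card B = 2" and ab: "a \<in> {u, v}" "b \<in> B"
      "({u, v} - B) \<union> (B - {u, v}) = {a, b}" "(a, b) \<in> parcs G"
    by (auto simp: token_graph2_def Let_def)
  have "a \<noteq> b" using ab(4) by (rule no_loops')
  \<comment> \<open>Both vertices lie in the symmetric difference, so neither is common to the two
    pairs: \<open>a\<close> is the vertex left and \<open>b\<close> the vertex entered.\<close>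
  have "a \<notin> B" "b \<notin> {u, v}" using ab by blast+
  obtain x y where xy: "B = {x, y}" "x \<noteq> y" using B by (auto simp: card_2_iff)
  show "(\<exists>w. (u, w) \<in> parcs G \<and> w \<noteq> v \<and> B = {w, v}) \<or> (\<exists>w. (v, w) \<in> parcs G \<and> w \<noteq> u \<and> B = {u, w})"
  proof (cases "a = u")
    case True
    have "v \<in> {a, b}" if "v \<notin> B" using that ab(3) by auto
    then have "v \<in> B" using True assms(3) \<open>b \<notin> {u, v}\<close> by auto
    then have "B = {b, v}" using xy ab(2) \<open>b \<notin> {u, v}\<close> by auto
    then show ?thesis using ab(4) True \<open>b \<notin> {u, v}\<close> by auto
  next
    case False
    then have "a = v" using ab(1) by simp
    have "u \<in> {a, b}" if "u \<notin> B" using that ab(3) by auto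
    then have "u \<in> B" using \<open>a = v\<close> assms(3) \<open>b \<notin> {u, v}\<close> by auto
    then have "B = {u, b}" using xy ab(2) \<open>b \<notin> {u, v}\<close> by auto
    then show ?thesis using ab(4) \<open>a = v\<close> \<open>b \<notin> {u, v}\<close> by auto
  qed
next
  have arc: "({x, y}, {w, y}) \<in> parcs (token_graph2 G)"
    if "x \<in> pverts G" "y \<in> pverts G" "x \<noteq> y" "(x, w) \<in> parcs G" "w \<noteq> y" for x y w
  proof -
    have "w \<in> pverts G" "x \<noteq> w" using that(4) by (auto dest: in_arcsD2 no_loops')
    then show ?thesis
      using that by (auto simp: token_graph2_def Let_def card_2_iff doubleton_eq_iff)
  qed
  assume "(\<exists>w. (u, w) \<in> parcs G \<and> w \<noteq> v \<and> B = {w, v}) \<or> (\<exists>w. (v, w) \<in> parcs G \<and> w \<noteq> u \<and> B = {u, w})"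
  then show "({u, v}, B) \<in> parcs (token_graph2 G)"
    using arc[of u v] arc[of v u] assms by (auto simp: insert_commute)
qed

lemma token_graph2_symmetric:
  "(A, B) \<in> parcs (token_graph2 G) \<longleftrightarrow> (B, A) \<in> parcs (token_graph2 G)"
proof -
  have "(B, A) \<in> parcs (token_graph2 G)" if arc: "(A, B) \<in> parcs (token_graph2 G)" for A B
  proof -
    obtain a b where ab: "a \<in> A" "b \<in> B" "(A - B) \<union> (B - A) = {a, b}" "(a, b) \<in> parcs G"
        and AB: "A \<subseteq> pverts G" "card A = 2" "B \<subseteq> pverts G" "card B = 2"
      using arc by (auto simp: token_graph2_def Let_def)
    have "(b, a) \<in> parcs G" "(B - A) \<union> (A - B) = {b, a}"
      using arcs_symmetric[OF ab(4)] ab(3) by (simp_all add: Un_commute insert_commute)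
    then have "\<exists>b\<in>B. \<exists>a\<in>A. (B - A) \<union> (A - B) = {b, a} \<and> (b, a) \<in> parcs G"
      using ab(1,2) by blast
    then show ?thesis using AB by (simp add: token_graph2_def Let_def)
  qed
  then show ?thesis by blast
qed

end

section \<open>Distance-regular graphs\<close>

locale distance_regular_graph =
  fixes G :: "'a pair_pre_digraph" and d :: nat and b c :: "nat \<Rightarrow> nat"
  assumes distance_regular: "distance_regular G d b c" and d_pos: "d \<ge> 1"

sublocale distance_regular_graph \<subseteq> connected_pair_graph
  using distance_regular unfolding distance_regular_def
  by (intro connected_pair_graph.intro connected_pair_graph_axioms.intro) auto

context distance_regular_graph
begin

text \<open>The entries of the tridiagonal intersection matrix of \<open>G\<close>.\<close>

definition nbr_count :: "nat \<Rightarrow> nat \<Rightarrow> real" where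
  "nbr_count i j = (if i = j then array_a b c i else if j = i + 1 then b i else if i = j + 1 then c i else 0)"

lemma card_arcs_at_ndist:
  assumes u: "u \<in> pverts G" and v: "v \<in> pverts G"
  shows "real (card {w. (v, w) \<in> parcs G \<and> ndist G u w = j}) = nbr_count (ndist G u v) j"
proof -
  let ?i = "ndist G u v"
  have gd: "(v, w) \<in> parcs G \<Longrightarrow> gdist G u w = ereal x \<longleftrightarrow> real (ndist G u w) = x" for w x
    using gdist_eq_iff[OF u] in_arcsD2 by blast
  have "card {w. (v, w) \<in> parcs G \<and> gdist G u w = ereal (real ?i - 1)} = c ?i \<and>
        real (card {w. (v, w) \<in> parcs G \<and> gdist G u w = ereal (real ?i)}) = array_a b c ?i \<and>
        card {w. (v, w) \<in> parcs G \<and> gdist G u w = ereal (real ?i + 1)} = b ?i"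
    using distance_regular u v gdist_eq_ndist[OF u v] unfolding distance_regular_def by blast
  then have cnt: "card {w. (v, w) \<in> parcs G \<and> real (ndist G u w) = real ?i - 1} = c ?i"
      "real (card {w. (v, w) \<in> parcs G \<and> real (ndist G u w) = real ?i}) = array_a b c ?i"
      "card {w. (v, w) \<in> parcs G \<and> real (ndist G u w) = real ?i + 1} = b ?i"
    by (simp_all add: gd cong: conj_cong)
  consider "?i = j" | "j = ?i + 1" | "?i = j + 1" | "?i \<noteq> j" "j \<noteq> ?i + 1" "?i \<noteq> j + 1" by blast
  then show ?thesis
  proof cases
    case 1
    then show ?thesis using cnt(2) by (simp add: nbr_count_def)
  next
    case 2
    have "{w. (v, w) \<in> parcs G \<and> real (ndist G u w) = real ?i + 1} =
        {w. (v, w) \<in> parcs G \<and> ndist G u w = j}" using 2 by auto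
    then show ?thesis using cnt(3) 2 by (simp add: nbr_count_def)
  next
    case 3
    have "{w. (v, w) \<in> parcs G \<and> real (ndist G u w) = real ?i - 1} =
        {w. (v, w) \<in> parcs G \<and> ndist G u w = j}" using 3 by auto
    then show ?thesis using cnt(1) 3 by (simp add: nbr_count_def)
  next
    case 4
    \<comment> \<open>Along an arc, taken in both directions, the distance from \<open>u\<close>
      changes by at most one.\<close>
    have "ndist G u w \<noteq> j" if "(v, w) \<in> parcs G" for w
      using ndist_arc_le[OF u that] ndist_arc_le[OF u arcs_symmetric[OF that]] 4 by auto
    then have no_arc: "{w. (v, w) \<in> parcs G \<and> ndist G u w = j} = {}" by auto
    show ?thesis unfolding no_arc using 4 by (simp add: nbr_count_def)
  qed
qed

lemma ndist_le_diameter: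
  assumes "u \<in> pverts G" "v \<in> pverts G"
  shows "ndist G u v \<le> d"
proof -
  have "gdist G u v \<le> diameter G"
    unfolding diameter_def using assms by (meson SUP_upper2 SUP_upper)
  also have "diameter G = ereal (real d)"
    using distance_regular by (simp add: distance_regular_def)
  finally show ?thesis using gdist_eq_ndist[OF assms] by simp
qed

text \<open>Distances are integers, so if all were below \<open>d\<close>, their supremum would be
  at most \<open>d - 1\<close>. From a pair at distance at least \<open>d\<close>, predecessors on
  shortest walks then realise all smaller distances one by one.\<close>

lemma ndist_attained:
  assumes "i \<le> d"
  obtains u v where "u \<in> pverts G" "v \<in> pverts G" "ndist G u v = i"
proof -
  have "\<exists>u\<in>pverts G. \<exists>v\<in>pverts G. d \<le> ndist G u v"
  proof (rule ccontr)
    assume "\<not> (\<exists>u\<in>pverts G. \<exists>v\<in>pverts G. d \<le> ndist G u v)"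
    then have less: "ndist G u v < d" if "u \<in> pverts G" "v \<in> pverts G" for u v
      using that by (meson not_less)
    have "gdist G u v \<le> ereal (real (d - 1))" if "u \<in> pverts G" "v \<in> pverts G" for u v
      using less[OF that] gdist_eq_ndist[OF that] by simp
    then have "diameter G \<le> ereal (real (d - 1))"
      unfolding diameter_def by (intro SUP_least)
    moreover have "diameter G = ereal (real d)"
      using distance_regular by (simp add: distance_regular_def)
    ultimately show False using d_pos by simp
  qed
  then obtain u v where uv: "u \<in> pverts G" "v \<in> pverts G" "d \<le> ndist G u v" by blast
  have "\<exists>v\<in>pverts G. ndist G u v = i"
    using assms
  proof (induction i rule: inc_induct)
    case base
    then show ?case using uv ndist_le_diameter[OF uv(1,2)] by auto
  next
    case (step i)
    then obtain v where "v \<in> pverts G" "ndist G u v = Suc i" by blast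
    then show ?case using uv(1) by (metis ndist_predecessor in_arcsD1)
  qed
  then show thesis using that uv(1) by blast
qed

text \<open>An arc between vertices at distances \<open>i\<close> and \<open>i + 1\<close> from
  \<open>u\<close> supplies a neighbour for both counts.\<close>

lemma b_pos_c_pos:
  assumes "i < d"
  shows "b i > 0" "c (Suc i) > 0"
proof -
  obtain u v where uv: "u \<in> pverts G" "v \<in> pverts G" "ndist G u v = Suc i"
    using ndist_attained[of "Suc i"] assms by auto
  then obtain w where w: "(w, v) \<in> parcs G" "ndist G u w = i"
    by (metis ndist_predecessor)
  have fin: "finite {y. (x, y) \<in> parcs G \<and> P y}" for x P
    by (rule finite_subset[OF _ pair_finite_verts]) (auto dest: in_arcsD2)
  have "card {y. (w, y) \<in> parcs G \<and> ndist G u y = Suc i} > 0"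
    using fin w uv by (auto simp: card_gt_0_iff)
  then show "b i > 0"
    using card_arcs_at_ndist[of u w "Suc i"] uv w by (auto simp: nbr_count_def dest: in_arcsD1)
  have "card {y. (v, y) \<in> parcs G \<and> ndist G u y = i} > 0"
    using fin w uv by (auto simp: card_gt_0_iff dest: arcs_symmetric)
  then show "c (Suc i) > 0"
    using card_arcs_at_ndist[of u v i] uv by (auto simp: nbr_count_def)
qed

lemma array_a_bipartite:
  assumes "bipartite G" "i \<le> d"
  shows "array_a b c i = 0"
proof -
  obtain u v where uv: "u \<in> pverts G" "v \<in> pverts G" "ndist G u v = i"
    using ndist_attained[OF assms(2)] by blast
  have no_arc: "{w. (v, w) \<in> parcs G \<and> ndist G u w = i} = {}"
    using bipartite_arc_ndist_neq[OF assms(1) uv(1)] uv(3) by blast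
  then show ?thesis
    using card_arcs_at_ndist[OF uv(1,2), of i] uv(3) unfolding no_arc by (simp add: nbr_count_def)
qed

section \<open>The distance partition of the token graph\<close>

text \<open>A pair can be read in two orders; for pairs of vertices the symmetry of the distance
  makes the described value unique.\<close>

definition pair_dist :: "'a set \<Rightarrow> nat" where
  "pair_dist A = (THE k. \<exists>u v. A = {u, v} \<and> u \<noteq> v \<and> ndist G u v = k)"

lemma pair_dist_doubleton:
  assumes "u \<in> pverts G" "v \<in> pverts G" "u \<noteq> v"
  shows "pair_dist {u, v} = ndist G u v"
  unfolding pair_dist_def using assms ndist_commute[OF assms(1,2)]
  by (intro the_equality) (auto simp: doubleton_eq_iff)

lemma token_vertexE:
  assumes "A \<in> pverts (token_graph2 G)"
  obtains u v where "A = {u, v}" "u \<in> pverts G" "v \<in> pverts G" "u \<noteq> v"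
  using assms by (auto simp: token_graph2_def Let_def card_2_iff)

lemma pair_dist_image: "pair_dist ` pverts (token_graph2 G) = {1..d}"
proof (intro equalityI subsetI)
  fix i assume "i \<in> pair_dist ` pverts (token_graph2 G)"
  then obtain u v where "u \<in> pverts G" "v \<in> pverts G" "u \<noteq> v" "i = ndist G u v"
    by (auto simp: pair_dist_doubleton elim!: token_vertexE)
  then show "i \<in> {1..d}"
    using ndist_le_diameter[of u v] ndist_eq_0_iff[of u v] by auto
next
  fix i assume i: "i \<in> {1..d}"
  then obtain u v where uv: "u \<in> pverts G" "v \<in> pverts G" "ndist G u v = i"
    using ndist_attained[of i] by auto
  then have "u \<noteq> v" using i by auto
  then have "{u, v} \<in> pverts (token_graph2 G)" "pair_dist {u, v} = i"
    using uv by (auto simp: token_graph2_def Let_def pair_dist_doubleton)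
  then show "i \<in> pair_dist ` pverts (token_graph2 G)" by force
qed

text \<open>Either token may move while the other rests. The moving token has
  \<open>nbr_count (pair_dist A) j\<close> targets at distance \<open>j\<close> from the resting
  one, the same number in both cases, hence the factor 2. The bound \<open>j \<ge> 1\<close> keeps
  it off the occupied vertex.\<close>

lemma card_token_arcs_at_pair_dist:
  assumes A: "A \<in> pverts (token_graph2 G)" and j: "j \<ge> 1"
  shows "real (card {B. (A, B) \<in> parcs (token_graph2 G) \<and> pair_dist B = j})
    = 2 * nbr_count (pair_dist A) j"
proof -
  obtain u v where uv: "A = {u, v}" "u \<in> pverts G" "v \<in> pverts G" "u \<noteq> v"
    using A by (rule token_vertexE)
  \<comment> \<open>The targets of the token at \<open>y\<close> when the token at \<open>x\<close>
    rests.\<close>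
  define N where "N = (\<lambda>x y. {w. (y, w) \<in> parcs G \<and> ndist G x w = j})"
  have N_neq: "w \<noteq> x" if "w \<in> N x y" "x \<in> pverts G" for w x y
    using that j by (auto simp: N_def)
  have fin: "finite (N x y)" for x y
    unfolding N_def by (rule finite_subset[OF _ pair_finite_verts]) (auto dest: in_arcsD2)
  have pd: "pair_dist {w, x} = ndist G x w" if "(y, w) \<in> parcs G" "x \<in> pverts G" "w \<noteq> x" for w x y
    using that pair_dist_doubleton[of x w] in_arcsD2[OF that(1)] by (simp add: insert_commute)
  have "{B. (A, B) \<in> parcs (token_graph2 G) \<and> pair_dist B = j} =
      (\<lambda>w. {w, v}) ` N v u \<union> (\<lambda>w. {w, u}) ` N u v" (is "?L = _")
  proof -
    have arc: "B \<in> ?L \<longleftrightarrow> ((\<exists>w. (u, w) \<in> parcs G \<and> w \<noteq> v \<and> B = {w, v}) \<or>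
        (\<exists>w. (v, w) \<in> parcs G \<and> w \<noteq> u \<and> B = {w, u})) \<and> pair_dist B = j" for B
      using token_graph2_arc_iff[OF uv(2-4), of B] by (simp add: uv(1) insert_commute)
    have N_iff: "w \<in> N x y \<longleftrightarrow> (y, w) \<in> parcs G \<and> w \<noteq> x \<and> pair_dist {w, x} = j"
      if "x \<in> pverts G" for w x y
      using N_neq[of w x y] pd[of y w x] that by (auto simp: N_def)
    have "B \<in> ?L \<longleftrightarrow> (\<exists>w\<in>N v u. B = {w, v}) \<or> (\<exists>w\<in>N u v. B = {w, u})" for B
      unfolding arc Bex_def N_iff[OF uv(2)] N_iff[OF uv(3)] by fast
    then show ?thesis by (intro Set.set_eqI) (simp only: Un_iff image_iff)
  qed
  \<comment> \<open>A common pair would have to be \<open>{u, v}\<close> itself, reached along a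
    loop.\<close>
  moreover have "(\<lambda>w. {w, v}) ` N v u \<inter> (\<lambda>w. {w, u}) ` N u v = {}"
    using uv no_loops' by (auto simp: N_def doubleton_eq_iff)
  moreover have "card ((\<lambda>w. {w, x}) ` N x y) = card (N x y)" for x y
    by (intro card_image inj_onI) (auto simp: doubleton_eq_iff)
  ultimately have "card {B. (A, B) \<in> parcs (token_graph2 G) \<and> pair_dist B = j} =
      card (N v u) + card (N u v)"
    using fin by (simp add: card_Un_disjoint)
  then show ?thesis
    using card_arcs_at_ndist[OF uv(2,3), of j] card_arcs_at_ndist[OF uv(3,2), of j] uv
    by (simp add: N_def pair_dist_doubleton ndist_commute[of v u])
qed

section \<open>Class sums of the adjacency and Laplacian matrices\<close>

definition token_adj :: "'a set \<Rightarrow> 'a set \<Rightarrow> real" where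
  "token_adj A B = of_bool ((A, B) \<in> parcs (token_graph2 G))"

definition token_lap :: "'a set \<Rightarrow> 'a set \<Rightarrow> real" where
  "token_lap A B =
    of_bool (A = B) * real (out_degree (with_proj (token_graph2 G)) A) - token_adj A B"

definition quot_adj :: "nat \<Rightarrow> nat \<Rightarrow> real" where
  "quot_adj i j = (if i = j then 2 * array_a b c i else quotient_offdiag b c i j)"

definition quot_deg :: "nat \<Rightarrow> real" where
  "quot_deg i = (\<Sum>k\<in>{1..d} - {i}. quotient_offdiag b c i k)"

definition quot_lap :: "nat \<Rightarrow> nat \<Rightarrow> real" where
  "quot_lap i j = (if i = j then quot_deg i else - quotient_offdiag b c i j)"

lemma adjacency_matrix_token_graph2:
  "adjacency_matrix (token_graph2 G) vs = list_mat token_adj vs vs"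
  by (auto simp: adjacency_matrix_def list_mat_def token_adj_def intro!: eq_matI)

lemma laplacian_matrix_token_graph2:
  assumes "distinct vs"
  shows "laplacian_matrix (token_graph2 G) vs = list_mat token_lap vs vs"
  by (rule eq_matI)
    (auto simp: laplacian_matrix_def adjacency_matrix_token_graph2 list_mat_def token_lap_def mat_diag_def
      nth_eq_iff_index_eq[OF assms])

lemma quotient_adjacency_eq: "quotient_adjacency d b c = mat d d (\<lambda>(i, j). quot_adj (i + 1) (j + 1))"
  by (rule eq_matI) (auto simp: quotient_adjacency_def quot_adj_def Let_def)

lemma quotient_laplacian_eq: "quotient_laplacian d b c = mat d d (\<lambda>(i, j). quot_lap (i + 1) (j + 1))"
  by (rule eq_matI) (auto simp: quotient_laplacian_def quot_lap_def quot_deg_def Let_def)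

lemma finite_token_verts: "finite (pverts (token_graph2 G))"
  by (rule finite_subset[OF _ finite_Pow_iff[THEN iffD2, OF pair_finite_verts]])
    (auto simp: token_graph2_def Let_def)

lemma token_arc_verts:
  assumes "(A, B) \<in> parcs (token_graph2 G)"
  shows "A \<in> pverts (token_graph2 G)" "B \<in> pverts (token_graph2 G)"
  using assms by (auto simp: token_graph2_def Let_def)

lemma token_adj_self: "token_adj A A = 0"
  by (auto simp: token_adj_def token_graph2_def Let_def)

lemma token_adj_class_sum:
  assumes "A \<in> pverts (token_graph2 G)" "j \<in> {1..d}"
  shows "(\<Sum>B | B \<in> pverts (token_graph2 G) \<and> pair_dist B = j. token_adj A B) = quot_adj (pair_dist A) j"
proof -
  have "(\<Sum>B | B \<in> pverts (token_graph2 G) \<and> pair_dist B = j. token_adj A B)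
      = real (card {B. (A, B) \<in> parcs (token_graph2 G) \<and> pair_dist B = j})"
    unfolding token_adj_def using finite_token_verts
    by (subst sum_of_bool_eq) (auto intro!: arg_cong[where f = card] dest: token_arc_verts)
  then show ?thesis
    using card_token_arcs_at_pair_dist[of A j] assms
    by (simp add: nbr_count_def quot_adj_def quotient_offdiag_def)
qed

lemma out_degree_token_graph2:
  assumes "A \<in> pverts (token_graph2 G)"
  shows "real (out_degree (with_proj (token_graph2 G)) A) = (\<Sum>j\<in>{1..d}. quot_adj (pair_dist A) j)"
proof -
  have "out_arcs (with_proj (token_graph2 G)) A = Pair A ` {B. (A, B) \<in> parcs (token_graph2 G)}"
    by (auto simp: out_arcs_def)
  then have "real (out_degree (with_proj (token_graph2 G)) A) = real (card {B. (A, B) \<in> parcs (token_graph2 G)})"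
    by (simp add: out_degree_def card_image inj_on_def)
  also have "\<dots> = (\<Sum>B\<in>pverts (token_graph2 G). token_adj A B)"
    unfolding token_adj_def using finite_token_verts
    by (subst sum_of_bool_eq) (auto intro!: arg_cong[where f = card] dest: token_arc_verts)
  also have "\<dots> = (\<Sum>j\<in>{1..d}. \<Sum>B | B \<in> pverts (token_graph2 G) \<and> pair_dist B = j. token_adj A B)"
    using finite_token_verts pair_dist_image by (intro sum.group[symmetric]) auto
  also have "\<dots> = (\<Sum>j\<in>{1..d}. quot_adj (pair_dist A) j)"
    by (intro sum.cong refl token_adj_class_sum assms)
  finally show ?thesis .
qed

lemma out_degree_token_graph2':
  assumes "A \<in> pverts (token_graph2 G)"
  shows "real (out_degree (with_proj (token_graph2 G)) A) =
    quot_adj (pair_dist A) (pair_dist A) + quot_deg (pair_dist A)"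
proof -
  have "pair_dist A \<in> {1..d}" using pair_dist_image assms by blast
  then show ?thesis
    unfolding out_degree_token_graph2[OF assms] quot_deg_def
    by (subst sum.remove[of _ "pair_dist A"]) (auto simp: quot_adj_def intro!: sum.cong)
qed

lemma diagonal_class_sum:
  assumes "A \<in> pverts (token_graph2 G)"
  shows "(\<Sum>B | B \<in> pverts (token_graph2 G) \<and> pair_dist B = j. of_bool (A = B) * x)
    = of_bool (pair_dist A = j) * (x :: real)"
proof -
  have "(\<Sum>B | B \<in> pverts (token_graph2 G) \<and> pair_dist B = j. of_bool (A = B) * x) =
      (\<Sum>B | B \<in> pverts (token_graph2 G) \<and> pair_dist B = j. if B = A then x else 0)"
    by (intro sum.cong) auto
  then show ?thesis using assms finite_token_verts by simp
qed

text \<open>The arcs inside a class count once in the degree and once, with the opposite sign, in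
  the adjacency part. They cancel, so the numbers \<open>array_a b c i\<close> do not appear in the
  quotient Laplacian.\<close>

lemma token_lap_class_sum:
  assumes "A \<in> pverts (token_graph2 G)" "j \<in> {1..d}"
  shows "(\<Sum>B | B \<in> pverts (token_graph2 G) \<and> pair_dist B = j. token_lap A B) = quot_lap (pair_dist A) j"
  unfolding token_lap_def sum_subtractf diagonal_class_sum[OF assms(1)] token_adj_class_sum[OF assms]
    out_degree_token_graph2'[OF assms(1)]
  by (auto simp: quot_lap_def quot_adj_def)

text \<open>The entrywise absolute value is the signless Laplacian, degree plus adjacency. In the
  bipartite case no arc stays inside a class, so the diagonal class sum is \<open>quot_deg\<close>,
  as it is for the Laplacian.\<close>

lemma token_lap_abs_class_sum:
  assumes "bipartite G" "A \<in> pverts (token_graph2 G)" "j \<in> {1..d}"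
  shows "(\<Sum>B | B \<in> pverts (token_graph2 G) \<and> pair_dist B = j. \<bar>token_lap A B\<bar>) = \<bar>quot_lap (pair_dist A) j\<bar>"
proof -
  have pd: "pair_dist A \<in> {1..d}" using pair_dist_image assms(2) by blast
  have "\<bar>token_lap A B\<bar> = of_bool (A = B) * real (out_degree (with_proj (token_graph2 G)) A) + token_adj A B" for B
    using token_adj_self[of A] by (auto simp: token_lap_def token_adj_def)
  moreover have "quot_adj (pair_dist A) (pair_dist A) = 0"
    using array_a_bipartite[OF assms(1)] pd by (simp add: quot_adj_def)
  moreover have "quot_deg i \<ge> 0" for i
    unfolding quot_deg_def by (intro sum_nonneg) (simp add: quotient_offdiag_def)
  ultimately show ?thesis
    by (simp add: sum.distrib diagonal_class_sum[OF assms(2)] token_adj_class_sum[OF assms(2,3)]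
        out_degree_token_graph2'[OF assms(2)])
      (auto simp: quot_lap_def quot_adj_def quotient_offdiag_def)
qed

section \<open>Spectral radii of the token graph\<close>

text \<open>The diagonal is left arbitrary, to cover both the quotient adjacency matrix and the
  absolute value of the quotient Laplacian.\<close>

lemma quotient_pos_eigenvector:
  "\<exists>w t. (\<forall>i\<in>{1..d}. w i > 0) \<and>
    (\<forall>i\<in>{1..d}. (\<Sum>j\<in>{1..d}. (if i = j then \<alpha> i else quotient_offdiag b c i j) * w j) = t * w i)"
proof (rule tridiag_pos_eigenvector[of d "\<lambda>i. 2 * real (b i)" "\<lambda>i. 2 * real (c i)" \<alpha>])
  show "2 * real (b i) > 0" if "1 \<le> i" "i < d" for i using b_pos_c_pos(1)[of i] that by simp
  show "2 * real (c i) > 0" if "1 < i" "i \<le> d" for i using b_pos_c_pos(2)[of "i - 1"] that by simp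
  show "1 \<le> d" by (rule d_pos)
next
  fix t w
  assume w: "w 0 = 0" "w (Suc d) = 0" "\<And>i. i \<in> {1..d} \<Longrightarrow> w i > 0"
    "\<And>i. i \<in> {1..d} \<Longrightarrow>
      \<alpha> i * w i + 2 * real (b i) * w (i + 1) + 2 * real (c i) * w (i - 1) = t * w i"
  have "(\<Sum>j\<in>{1..d}. (if i = j then \<alpha> i else quotient_offdiag b c i j) * w j) = t * w i"
    if i: "i \<in> {1..d}" for i
    unfolding quotient_offdiag_def w(4)[OF i, symmetric] sum_tridiagonal[OF i w(1,2), symmetric] ..
  then show ?thesis using w(3) by (intro exI conjI ballI)
qed

lemma largest_eigenvalue_token_adjacency:
  assumes "distinct vs" "set vs = pverts (token_graph2 G)"
  shows "largest_eigenvalue (adjacency_matrix (token_graph2 G) vs) =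
    largest_eigenvalue (quotient_adjacency d b c)"
proof -
  obtain w t where w: "\<forall>i\<in>{1..d}. w i > 0"
    "\<forall>i\<in>{1..d}. (\<Sum>j\<in>{1..d}. quot_adj i j * w j) = t * w i"
    using quotient_pos_eigenvector[of "\<lambda>i. 2 * array_a b c i"] unfolding quot_adj_def
    by (elim exE conjE)
  have "w 1 \<noteq> 0" using w(1)[rule_format, of 1] d_pos by simp
  moreover have "\<bar>token_adj A B\<bar> = token_adj A B" for A B by (simp add: token_adj_def)
  ultimately show ?thesis
    unfolding adjacency_matrix_token_graph2 quotient_adjacency_eq
    using assms pair_dist_image w token_adj_class_sum d_pos
    by (intro equitable_largest_eigenvalue[where cl = pair_dist and C = quot_adj and w = w and u = w and k = 1])
      auto
qed

lemma largest_eigenvalue_token_laplacian: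
  assumes "bipartite G" "distinct vs" "set vs = pverts (token_graph2 G)"
  shows "largest_eigenvalue (laplacian_matrix (token_graph2 G) vs) =
    largest_eigenvalue (quotient_laplacian d b c)"
proof -
  have deg: "quot_deg i \<ge> 0" for i
    unfolding quot_deg_def by (intro sum_nonneg) (simp add: quotient_offdiag_def)
  then have abs_lap: "\<bar>quot_lap i j\<bar> = (if i = j then quot_deg i else quotient_offdiag b c i j)" for i j
    by (simp add: quot_lap_def quotient_offdiag_def)
  obtain w t where w: "\<forall>i\<in>{1..d}. w i > 0"
    "\<forall>i\<in>{1..d}. (\<Sum>j\<in>{1..d}. \<bar>quot_lap i j\<bar> * w j) = t * w i"
    using quotient_pos_eigenvector[of quot_deg] unfolding abs_lap by (elim exE conjE)
  \<comment> \<open>Off-diagonal entries of a tridiagonal matrix join indices of opposite parity.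
    Alternating signs therefore turn an eigenvector of the absolute value into one of
    \<open>quot_lap\<close> with the same eigenvalue \<open>t\<close>.\<close>
  define u where "u = (\<lambda>i. (- 1) ^ i * w i)"
  have "(\<Sum>j\<in>{1..d}. quot_lap i j * u j) = t * u i" if "i \<in> {1..d}" for i
  proof -
    have "quot_lap i j * u j = (- 1) ^ i * (\<bar>quot_lap i j\<bar> * w j)" for j
      unfolding abs_lap by (simp add: quot_lap_def quotient_offdiag_def u_def)
    then have "(\<Sum>j\<in>{1..d}. quot_lap i j * u j) = (- 1) ^ i * (\<Sum>j\<in>{1..d}. \<bar>quot_lap i j\<bar> * w j)"
      by (simp add: sum_distrib_left)
    then show ?thesis unfolding w(2)[rule_format, OF that] u_def by simp
  qed
  moreover have "u 1 \<noteq> 0" using w(1)[rule_format, of 1] d_pos by (simp add: u_def)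
  ultimately show ?thesis
    unfolding laplacian_matrix_token_graph2[OF assms(2)] quotient_laplacian_eq
    using assms pair_dist_image w token_lap_class_sum token_lap_abs_class_sum d_pos
    by (intro equitable_largest_eigenvalue[where cl = pair_dist and C = "\<lambda>i j. \<bar>quot_lap i j\<bar>"
          and w = w and u = u and k = 1]) auto
qed

end

theorem corollary5p4:
  fixes G :: "'a pair_pre_digraph" and d :: nat and b c :: "nat \<Rightarrow> nat"
    and vs :: "'a set list"
  assumes "d \<ge> 1"
    and "distance_regular G d b c"
    and "distinct vs" and "set vs = pverts (token_graph2 G)"
  shows
    "size (eigenvalues_mset (quotient_adjacency d b c)) = d \<and>
     eigenvalues_mset (quotient_adjacency d b c)
       \<subseteq># eigenvalues_mset (adjacency_matrix (token_graph2 G) vs) \<and>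
     size (eigenvalues_mset (quotient_laplacian d b c)) = d \<and>
     eigenvalues_mset (quotient_laplacian d b c)
       \<subseteq># eigenvalues_mset (laplacian_matrix (token_graph2 G) vs) \<and>
     largest_eigenvalue (adjacency_matrix (token_graph2 G) vs)
       = largest_eigenvalue (quotient_adjacency d b c) \<and>
     (bipartite G \<longrightarrow>
        largest_eigenvalue (laplacian_matrix (token_graph2 G) vs)
          = largest_eigenvalue (quotient_laplacian d b c))"
proof -
  interpret distance_regular_graph G d b c
    using assms(1,2) by unfold_locales
  have cl: "pair_dist ` set vs = {1..d}" using pair_dist_image assms(4) by simp
  have sym_adj: "token_adj A B = token_adj B A" for A B
    using token_graph2_symmetric[of A B] by (simp add: token_adj_def)
  then have sym_lap: "token_lap A B = token_lap B A" for A B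
    by (simp add: token_lap_def)
  show ?thesis
    unfolding adjacency_matrix_token_graph2 laplacian_matrix_token_graph2[OF assms(3)]
      quotient_adjacency_eq quotient_laplacian_eq
    using equitable_eigenvalues_mset[where F = token_adj and B = quot_adj, OF assms(3) cl sym_adj]
      equitable_eigenvalues_mset[where F = token_lap and B = quot_lap, OF assms(3) cl sym_lap]
      token_adj_class_sum token_lap_class_sum
      largest_eigenvalue_token_adjacency[OF assms(3,4)]
      largest_eigenvalue_token_laplacian[OF _ assms(3,4)]
    by (simp add: assms(4) adjacency_matrix_token_graph2 laplacian_matrix_token_graph2[OF assms(3)]
      quotient_adjacency_eq quotient_laplacian_eq)
qed

end
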